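(* Let $\frac13\leq p\leq\frac12$. If $\mathcal F_1,\mathcal F_2,\mathcal F_3\subset 2^{[n]}$ are non-empty $3$-cross intersecting families, then $$\mu_p(\mathcal F_1)+\mu_p(\mathcal F_2)+\mu_p(\mathcal F_3)\leq 3p.$$ Suppose, moreover, that $\frac13<p\leq\frac12$, that all $\mathcal F_i$ ($i=1,2,3$) are shifted, and that $\bigcap F=\emptyset$, where the intersection is taken over all $F\in\mathcal F_1\cup\mathcal F_2\cup\mathcal F_3$. Then $$\mu_p(\mathcal F_1)+\mu_p(\mathcal F_2)+\mu_p(\mathcal F_3)\leq 3p-\epsilon_p,$$ where $\epsilon_p=(2-3p)(3p-1)$.
   Context: Let $n\ge1$, $[n]=\{1,2,\ldots,n\}$, and let $2^{[n]}$ be its power set. For $0<p<1$, $q=1-p$, the $p$-measure of a family $\mathcal G\subset 2^{[n]}$ is $\mu_p(\mathcal G)=\sum_{G\in\mathcal G}p^{|G|}q^{n-|G|}$. Families $\mathcal F_1,\mathcal F_2,\mathcal F_3\subset 2^{[n]}$ are $3$-cross intersecting if $F_1\cap F_2\cap F_3\neq\emptyset$ for all $F_1\in\mathcal F_1$, $F_2\in\mathcal F_2$, $F_3\in\mathcal F_3$; they are non-empty $3$-cross intersecting if moreover $\mathcal F_i\neq\emptyset$ for every $i=1,2,3$. A family $\mathcal F\subset 2^{[n]}$ is shifted if, whenever $F\in\mathcal F$ and $1\leq i<j\leq n$ satisfy $F\cap\{i,j\}=\{j\}$, then $(F\setminus\{j\})\cup\{i\}\in\mathcal F$. *)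

theory Defs
  imports Complex_Main
begin

definition p_measure :: "nat \<Rightarrow> real \<Rightarrow> nat set set \<Rightarrow> real" where
  "p_measure n p \<G> = (\<Sum>G\<in>\<G>. p ^ card G * (1 - p) ^ (n - card G))"

definition cross_intersecting3 :: "'a set set \<Rightarrow> 'a set set \<Rightarrow> 'a set set \<Rightarrow> bool" where
  "cross_intersecting3 \<F>1 \<F>2 \<F>3 \<longleftrightarrow>
     (\<forall>F1\<in>\<F>1. \<forall>F2\<in>\<F>2. \<forall>F3\<in>\<F>3. F1 \<inter> F2 \<inter> F3 \<noteq> {})"

definition nonempty_cross_intersecting3 ::
    "'a set set \<Rightarrow> 'a set set \<Rightarrow> 'a set set \<Rightarrow> bool" where
  "nonempty_cross_intersecting3 \<F>1 \<F>2 \<F>3 \<longleftrightarrow>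
     cross_intersecting3 \<F>1 \<F>2 \<F>3 \<and> \<F>1 \<noteq> {} \<and> \<F>2 \<noteq> {} \<and> \<F>3 \<noteq> {}"

definition shifted :: "nat \<Rightarrow> nat set set \<Rightarrow> bool" where
  "shifted n \<F> \<longleftrightarrow>
     (\<forall>F\<in>\<F>. \<forall>i j. 1 \<le> i \<and> i < j \<and> j \<le> n \<and> F \<inter> {i, j} = {j} \<longrightarrow>
        (F - {j}) \<union> {i} \<in> \<F>)"

end

theory Submission
  imports Defs
begin

text \<open>
  Passing to up-closures, split every family at an element \<open>x\<close> into its link (members containing
  \<open>x\<close>, with \<open>x\<close> removed) and its deletion (members avoiding \<open>x\<close>). One deletion together with two
  links is again cross intersecting, so if \<open>a\<close> and \<open>b\<close> are the sums of the measures of the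
  links and of the deletions, a bound \<open>c\<close> for the smaller ground set gives \<open>2 * a + b \<le> 3 * c\<close>.
  As \<open>b \<le> a\<close>, this yields \<open>p * a + (1 - p) * b \<le> c\<close>. The induction only fails when a deletion
  is empty or, in the second part, when one of these triples has a common element. In the second
  part, shiftedness forces an empty deletion to come from the family consisting of the ground set
  alone, and a common element to come from a family with a single member avoiding \<open>1\<close>. In these
  cases two of the families are cross intersecting on their own, and the sharp bound
  \<open>1 - (1 - p) ^ n + p ^ n\<close> for two families suffices.
\<close>

section \<open>Links, deletions and the measure on a finite ground set\<close>

definition link :: "'a \<Rightarrow> 'a set set \<Rightarrow> 'a set set" where
  "link x F = {A. x \<notin> A \<and> insert x A \<in> F}"

definition del :: "'a \<Rightarrow> 'a set set \<Rightarrow> 'a set set" where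
  "del x F = {A \<in> F. x \<notin> A}"

definition upset_on :: "'a set \<Rightarrow> 'a set set \<Rightarrow> bool" where
  "upset_on S F \<longleftrightarrow> F \<subseteq> Pow S \<and> (\<forall>A\<in>F. \<forall>B. A \<subseteq> B \<and> B \<subseteq> S \<longrightarrow> B \<in> F)"

definition up_closure :: "'a set \<Rightarrow> 'a set set \<Rightarrow> 'a set set" where
  "up_closure S F = {B. B \<subseteq> S \<and> (\<exists>A\<in>F. A \<subseteq> B)}"

text \<open>The ground set is an arbitrary set instead of \<open>{1..n}\<close>, so that the
  inductions can remove any element, not only the largest. Members of \<open>F\<close> outside
  \<open>S\<close> are not discarded, which is why upper bounds carry \<open>F\<close> as a subset
  of \<open>Pow S\<close>.\<close>

definition mu :: "'a set \<Rightarrow> real \<Rightarrow> 'a set set \<Rightarrow> real" where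
  "mu S p F = (\<Sum>A\<in>F. p ^ card A * (1 - p) ^ (card S - card A))"

lemma p_measure_eq_mu: "p_measure n p F = mu {1..n} p F"
  by (simp add: p_measure_def mu_def)

lemma upset_on_subset: "upset_on S F \<Longrightarrow> F \<subseteq> Pow S"
  by (simp add: upset_on_def)

lemma upset_onD: "upset_on S F \<Longrightarrow> A \<in> F \<Longrightarrow> A \<subseteq> B \<Longrightarrow> B \<subseteq> S \<Longrightarrow> B \<in> F"
  by (auto simp: upset_on_def)

lemma upset_on_whole: "upset_on S F \<Longrightarrow> F \<noteq> {} \<Longrightarrow> S \<in> F"
  unfolding upset_on_def by blast

lemma upset_on_link:
  assumes "upset_on (insert x S) F" "x \<notin> S"
  shows "upset_on S (link x F)"
  unfolding upset_on_def
proof (intro conjI ballI allI impI)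
  show "link x F \<subseteq> Pow S"
    using upset_on_subset[OF assms(1)] unfolding link_def by blast
  fix A B
  assume A: "A \<in> link x F" and B: "A \<subseteq> B \<and> B \<subseteq> S"
  have "insert x B \<in> F"
    by (rule upset_onD[OF assms(1), of "insert x A"]) (use A B in \<open>auto simp: link_def\<close>)
  then show "B \<in> link x F"
    using B assms(2) by (auto simp: link_def)
qed

lemma upset_on_del: "upset_on (insert x S) F \<Longrightarrow> x \<notin> S \<Longrightarrow> upset_on S (del x F)"
  unfolding upset_on_def del_def by blast

lemma del_subset_link: "upset_on (insert x S) F \<Longrightarrow> del x F \<subseteq> link x F"
  unfolding upset_on_def del_def link_def by blast

lemma link_nonempty:
  assumes "upset_on (insert x S) F" "x \<notin> S" "F \<noteq> {}"
  shows "link x F \<noteq> {}"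
proof -
  have "S \<in> link x F"
    using upset_on_whole[OF assms(1,3)] assms(2) by (simp add: link_def)
  then show ?thesis by auto
qed

text \<open>This conditions on whether the random set contains \<open>x\<close>: members containing
  \<open>x\<close> are the images of link members under \<open>insert x\<close> and gain a factor
  \<open>p\<close>, the others gain a factor \<open>1 - p\<close>.\<close>

lemma mu_split:
  assumes "finite S" "x \<notin> S" "F \<subseteq> Pow (insert x S)"
  shows "mu (insert x S) p F = p * mu S p (link x F) + (1 - p) * mu S p (del x F)"
proof -
  have fin: "finite F"
    using assms by (meson finite_Pow_iff finite_insert finite_subset)
  have F: "F = insert x ` link x F \<union> del x F"
  proof (intro equalityI subsetI)
    fix A assume "A \<in> F"
    then show "A \<in> insert x ` link x F \<union> del x F"
      by (cases "x \<in> A") (auto simp: link_def del_def insert_absorb intro!: image_eqI[of _ _ "A - {x}"])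
  qed (auto simp: link_def del_def)
  have disj: "insert x ` link x F \<inter> del x F = {}"
    by (auto simp: del_def)
  have inj: "inj_on (insert x) (link x F)"
    by (auto simp: inj_on_def link_def)
  have sub: "A \<subseteq> S" if "A \<in> link x F \<or> A \<in> del x F" for A
    using that assms by (auto simp: link_def del_def)
  have w: "card (insert x A) = Suc (card A)" if "A \<in> link x F" for A
    using that sub[of A] assms(1) finite_subset by (fastforce simp: link_def)
  have d: "Suc (card S) - card A = Suc (card S - card A)" if "A \<in> del x F" for A
    using sub[of A] that assms(1) by (simp add: Suc_diff_le card_mono)
  have "finite (insert x ` link x F)" "finite (del x F)"
    using fin F by (metis finite_Un)+
  then have "mu (insert x S) p F =
      (\<Sum>A\<in>insert x ` link x F. p ^ card A * (1 - p) ^ (Suc (card S) - card A)) +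
      (\<Sum>A\<in>del x F. p ^ card A * (1 - p) ^ (Suc (card S) - card A))"
    using sum.union_disjoint[OF _ _ disj] F assms unfolding mu_def by simp
  also have "(\<Sum>A\<in>insert x ` link x F. p ^ card A * (1 - p) ^ (Suc (card S) - card A))
      = p * mu S p (link x F)"
    unfolding mu_def sum.reindex[OF inj] sum_distrib_left
    by (intro sum.cong) (auto simp: w)
  also have "(\<Sum>A\<in>del x F. p ^ card A * (1 - p) ^ (Suc (card S) - card A))
      = (1 - p) * mu S p (del x F)"
    unfolding mu_def sum_distrib_left
    by (intro sum.cong) (auto simp: d)
  finally show ?thesis .
qed

lemma mu_empty [simp]: "mu S p {} = 0"
  by (simp add: mu_def)

lemma mu_whole: "mu S p {S} = p ^ card S"
  by (simp add: mu_def)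

lemma mu_Pow: "finite S \<Longrightarrow> mu S p (Pow S) = 1"
proof (induction S rule: finite_induct)
  case empty
  then show ?case by (simp add: mu_def)
next
  case (insert x S)
  have "link x (Pow (insert x S)) = Pow S" "del x (Pow (insert x S)) = Pow S"
    using insert.hyps by (auto simp: link_def del_def)
  then show ?case
    using mu_split[OF insert.hyps, of "Pow (insert x S)" p] insert.IH by simp
qed

context
  fixes p :: real
  assumes p: "0 \<le> p" "p \<le> 1"
begin

lemma mu_mono:
  assumes "finite S" "G \<subseteq> Pow S" "F \<subseteq> G"
  shows "mu S p F \<le> mu S p G"
  unfolding mu_def using p assms by (intro sum_mono2) (auto intro: finite_subset)

lemma mu_le_1:
  assumes "finite S" "F \<subseteq> Pow S"
  shows "mu S p F \<le> 1"
  using mu_mono[OF assms(1) order_refl assms(2)] mu_Pow[OF assms(1)] by simp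

text \<open>The empty set has weight \<open>(1 - p) ^ card S\<close>, and adding it to
  \<open>F\<close> still leaves the total at most 1.\<close>

lemma mu_le_of_empty_notin:
  assumes "finite S" "F \<subseteq> Pow S" "{} \<notin> F"
  shows "mu S p F \<le> 1 - (1 - p) ^ card S"
proof -
  have "mu S p F + (1 - p) ^ card S = mu S p (insert {} F)"
    using assms by (simp add: mu_def finite_subset[of F "Pow S"])
  also have "\<dots> \<le> 1"
    using assms by (intro mu_le_1) auto
  finally show ?thesis by simp
qed

end

section \<open>Two cross intersecting families\<close>

lemma power_diff_antimono:
  fixes p :: real
  assumes "0 \<le> p" "p \<le> 1 / 2" "1 \<le> n"
  shows "(1 - p) ^ Suc n - p ^ Suc n \<le> (1 - p) ^ n - p ^ n"
proof -
  obtain m where n: "n = Suc m"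
    using assms(3) by (cases n) auto
  \<comment> \<open>The right side minus the left side is
    \<open>p * (1 - p) * ((1 - p) ^ m - p ^ m)\<close>. For \<open>n = 0\<close> the difference of
    powers would instead rise from 0 to \<open>1 - 2 * p\<close>.\<close>
  have "p ^ m \<le> (1 - p) ^ m"
    using assms by (intro power_mono) auto
  then have "p * (1 - p) * p ^ m \<le> p * (1 - p) * (1 - p) ^ m"
    using assms by (intro mult_left_mono) auto
  then show ?thesis
    by (simp add: n algebra_simps)
qed

lemma power_diff_le:
  fixes p :: real
  assumes "0 \<le> p" "p \<le> 1 / 2" "1 \<le> n"
  shows "(1 - p) ^ n - p ^ n \<le> 1 - 2 * p"
  using assms(3)
proof (induction n rule: dec_induct)
  case (step n)
  then show ?case
    using power_diff_antimono[OF assms(1,2), of n] by simp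
qed simp

lemma power_diff_nonneg:
  fixes p :: real
  assumes "0 \<le> p" "p \<le> 1 / 2"
  shows "0 \<le> (1 - p) ^ n - p ^ n"
  using power_mono[of p "1 - p" n] assms by simp

text \<open>Equality is attained for nonempty \<open>S\<close> when one family is \<open>{S}\<close>
  and the other consists of all nonempty subsets. The induction splits at \<open>x\<close>: a link
  of one family and a deletion of the other remain cross intersecting, because \<open>x\<close>
  cannot be their common element.\<close>

lemma mu_cross_intersecting2:
  assumes p: "0 \<le> p" "p \<le> 1 / 2"
    and "finite S" "upset_on S F" "upset_on S G" "F \<noteq> {}" "G \<noteq> {}"
    and "\<And>A B. A \<in> F \<Longrightarrow> B \<in> G \<Longrightarrow> A \<inter> B \<noteq> {}"
  shows "mu S p F + mu S p G \<le> 1 - (1 - p) ^ card S + p ^ card S"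
  using assms(3-)
proof (induction S arbitrary: F G rule: finite_induct)
  case empty
  have "{} \<in> F" "{} \<in> G"
    using empty.prems upset_on_whole by blast+
  then show ?case using empty.prems(5) by blast
next
  case (insert x S)
  have p1: "p \<le> 1" using p by simp
  let ?s = "1 - (1 - p) ^ card S + p ^ card S"
  let ?t = "1 - (1 - p) ^ Suc (card S) + p ^ Suc (card S)"
  have one_deletion: "mu S p (link x F) + mu S p (del x G) \<le> ?s"
    if "upset_on (insert x S) F" "upset_on (insert x S) G" "F \<noteq> {}" "del x G \<noteq> {}"
      "\<And>A B. A \<in> F \<Longrightarrow> B \<in> G \<Longrightarrow> A \<inter> B \<noteq> {}" for F G
    using that insert.hyps
    by (intro insert.IH upset_on_link upset_on_del link_nonempty)
      (auto simp: link_def del_def)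
  have one_empty: "mu (insert x S) p F + mu (insert x S) p G \<le> ?t"
    if u: "upset_on (insert x S) F" "upset_on (insert x S) G" and ne: "F \<noteq> {}" "del x G \<noteq> {}"
      and e: "del x F = {}"
      and c: "\<And>A B. A \<in> F \<Longrightarrow> B \<in> G \<Longrightarrow> A \<inter> B \<noteq> {}" for F G
  proof -
    have "{} \<notin> del x G"
      using c ne by (auto simp: del_def)
    then have "mu S p (del x G) \<le> 1 - (1 - p) ^ card S"
      using mu_le_of_empty_notin[OF p(1) p1 insert.hyps(1)]
        upset_on_del[OF u(2) insert.hyps(2)] by (simp add: upset_on_def)
    moreover have "mu S p (link x G) \<le> 1"
      using mu_le_1[OF p(1) p1 insert.hyps(1)]
        upset_on_link[OF u(2) insert.hyps(2)] by (simp add: upset_on_def)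
    moreover have "mu S p (link x F) + mu S p (del x G) \<le> ?s"
      by (rule one_deletion) (use u ne c in auto)
    \<comment> \<open>With \<open>del x F\<close> empty, the total is this sum of three pieces.
      Their separate bounds add up to exactly \<open>?t\<close>.\<close>
    ultimately have "p * (mu S p (link x F) + mu S p (del x G)) \<le> p * ?s"
      "p * mu S p (link x G) \<le> p * 1"
      "(1 - 2 * p) * mu S p (del x G) \<le> (1 - 2 * p) * (1 - (1 - p) ^ card S)"
      using p by (auto intro!: mult_left_mono simp del: mult_1_right)
    then have
      "p * (mu S p (link x F) + mu S p (del x G)) + p * mu S p (link x G)
        + (1 - 2 * p) * mu S p (del x G)
      \<le> p * ?s + p * 1 + (1 - 2 * p) * (1 - (1 - p) ^ card S)"
      by linarith
    then show ?thesis
      using mu_split[OF insert.hyps upset_on_subset[OF u(1)], of p]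
        mu_split[OF insert.hyps upset_on_subset[OF u(2)], of p] e
      by (simp add: algebra_simps)
  qed
  have swapped: "\<And>A B. A \<in> G \<Longrightarrow> B \<in> F \<Longrightarrow> A \<inter> B \<noteq> {}"
    using insert.prems(5) by blast
  note split = mu_split[OF insert.hyps upset_on_subset[OF insert.prems(1)], of p]
    mu_split[OF insert.hyps upset_on_subset[OF insert.prems(2)], of p]
  note le1 = mu_le_1[OF p(1) p1 insert.hyps(1)
      upset_on_subset[OF upset_on_link[OF _ insert.hyps(2)]]]
  have "mu (insert x S) p F + mu (insert x S) p G \<le> ?t"
  proof (cases "del x F = {}"; cases "del x G = {}")
    assume e: "del x F = {}" "del x G = {}"
    have "p * mu S p (link x F) + p * mu S p (link x G) \<le> p * 1 + p * 1"
      using p le1 insert.prems by (intro add_mono mult_left_mono) auto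
    moreover have "(1 - p) ^ Suc (card S) - p ^ Suc (card S) \<le> 1 - 2 * p"
      using p by (intro power_diff_le) auto
    ultimately show ?thesis using split e by simp
  next
    assume e: "del x F = {}" "del x G \<noteq> {}"
    then show ?thesis using one_empty[of F G] insert.prems by blast
  next
    assume e: "del x F \<noteq> {}" "del x G = {}"
    then show ?thesis using one_empty[of G F] insert.prems swapped by (simp add: add.commute)
  next
    assume e: "del x F \<noteq> {}" "del x G \<noteq> {}"
    have s: "mu S p (link x F) + mu S p (del x G) \<le> ?s"
      using one_deletion[of F G] insert.prems e by blast
    have t: "mu S p (link x G) + mu S p (del x F) \<le> ?s"
      using one_deletion[of G F] insert.prems e swapped by blast
    have d: "mu S p (del x G) \<le> mu S p (link x G)"
      using mu_mono[OF p(1) p1 insert.hyps(1)] del_subset_link[OF insert.prems(2)]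
        upset_on_subset[OF upset_on_link[OF insert.prems(2) insert.hyps(2)]] by blast
    have "mu S p (del x F) + mu S p (del x G) \<le> ?s"
      using t d by linarith
    \<comment> \<open>The weights \<open>p\<close>, \<open>p\<close> and \<open>1 - 2 * p\<close>
      add up to 1 and recombine to the two split measures, so the bound \<open>?s\<close> for the
      smaller ground set survives. Replacing \<open>?s\<close> by \<open>?t\<close> then needs
      \<open>S\<close> nonempty.\<close>
    then have "p * (mu S p (link x F) + mu S p (del x G)) \<le> p * ?s"
      "p * (mu S p (link x G) + mu S p (del x F)) \<le> p * ?s"
      "(1 - 2 * p) * (mu S p (del x F) + mu S p (del x G)) \<le> (1 - 2 * p) * ?s"
      using s t p by (auto intro!: mult_left_mono)
    then have "p * (mu S p (link x F) + mu S p (del x G)) + p * (mu S p (link x G) + mu S p (del x F))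
        + (1 - 2 * p) * (mu S p (del x F) + mu S p (del x G)) \<le> p * ?s + p * ?s + (1 - 2 * p) * ?s"
      by linarith
    then have "mu (insert x S) p F + mu (insert x S) p G \<le> ?s"
      using split by (simp add: algebra_simps)
    moreover have "S \<noteq> {}"
    proof
      assume "S = {}"
      then have "{} \<in> del x F"
        using upset_on_whole[OF upset_on_del[OF insert.prems(1) insert.hyps(2)] e(1)] by simp
      then show False
        using insert.prems(4,5) by (fastforce simp: del_def)
    qed
    then have "?s \<le> ?t"
      using power_diff_antimono[OF p, of "card S"] insert.hyps(1)
      by (simp add: Suc_le_eq card_gt_0_iff)
    ultimately show ?thesis by linarith
  qed
  then show ?case using insert.hyps by simp
qed

lemma mu_cross_intersecting2_le_1:
  assumes "0 \<le> p" "p \<le> 1 / 2" "finite S" "upset_on S F" "upset_on S G"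
    and "\<And>A B. A \<in> F \<Longrightarrow> B \<in> G \<Longrightarrow> A \<inter> B \<noteq> {}"
  shows "mu S p F + mu S p G \<le> 1"
proof (cases "F = {} \<or> G = {}")
  case True
  then show ?thesis
    using mu_le_1[of p S F] mu_le_1[of p S G] assms by (auto simp: upset_on_def)
next
  case False
  then show ?thesis
    using mu_cross_intersecting2[OF assms(1-5)] assms(6) power_diff_nonneg[OF assms(1,2)]
    by (smt (verit))
qed

section \<open>Three families: the bound \<open>3 * p\<close>\<close>

definition triple :: "'a set \<Rightarrow> 'a set set \<Rightarrow> 'a set set \<Rightarrow> 'a set set \<Rightarrow> bool" where
  "triple S F G H \<longleftrightarrow> upset_on S F \<and> upset_on S G \<and> upset_on S H \<and>
     nonempty_cross_intersecting3 F G H"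

lemma triple_upset:
  assumes "triple S F G H"
  shows "upset_on S F" "upset_on S G" "upset_on S H"
  using assms by (simp_all add: triple_def)

lemma triple_nonempty:
  assumes "triple S F G H"
  shows "F \<noteq> {}" "G \<noteq> {}" "H \<noteq> {}"
  using assms by (simp_all add: triple_def nonempty_cross_intersecting3_def)

lemma triple_inter:
  assumes "triple S F G H" "A \<in> F" "B \<in> G" "C \<in> H"
  shows "A \<inter> B \<inter> C \<noteq> {}"
  using assms unfolding triple_def nonempty_cross_intersecting3_def cross_intersecting3_def
  by blast

lemma not_triple_empty: "\<not> triple {} F G H"
  using triple_inter[of "{}" F G H "{}" "{}" "{}"] triple_upset[of "{}" F G H]
    triple_nonempty[of "{}" F G H] upset_on_whole by blast

lemma triple_swap: "triple S F G H \<Longrightarrow> triple S G F H" "triple S F G H \<Longrightarrow> triple S F H G"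
  unfolding triple_def nonempty_cross_intersecting3_def cross_intersecting3_def
  by blast+

text \<open>A member of the deletion avoids \<open>x\<close>, so the common element of the three
  enlarged sets differs from \<open>x\<close>. A single deletion among the three is enough for
  this.\<close>

lemma triple_del_link:
  assumes "triple (insert x S) F G H" "x \<notin> S" "del x F \<noteq> {}"
  shows "triple S (del x F) (link x G) (link x H)"
proof -
  have "cross_intersecting3 (del x F) (link x G) (link x H)"
    unfolding cross_intersecting3_def
  proof (intro ballI)
    fix A B C
    assume "A \<in> del x F" "B \<in> link x G" "C \<in> link x H"
    then have "A \<inter> insert x B \<inter> insert x C \<noteq> {}" "x \<notin> A"
      using triple_inter[OF assms(1)] unfolding del_def link_def by blast+
    then show "A \<inter> B \<inter> C \<noteq> {}" by blast
  qed
  then show ?thesis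
    using assms triple_upset[OF assms(1)] triple_nonempty[OF assms(1)]
    unfolding triple_def nonempty_cross_intersecting3_def
    by (simp add: upset_on_del upset_on_link link_nonempty)
qed

text \<open>The gap is \<open>(3 * p - 1) * (1 - p)\<close>. The left side is the bound reached
  below when one or two deletions are empty, and \<open>1 / 3 \<le> p\<close> makes it
  admissible.\<close>

lemma quadratic_le:
  fixes p :: real
  assumes "1 / 3 \<le> p" "p \<le> 1 / 2"
  shows "3 * p\<^sup>2 + 1 - p \<le> 3 * p"
proof -
  have "(3 * p - 1) * (1 - p) \<ge> 0"
    using assms by simp
  then show ?thesis by (simp add: algebra_simps power2_eq_square)
qed

text \<open>With \<open>a\<close> and \<open>b\<close> the sums of the \<open>ai\<close> and
  \<open>bi\<close>, the left side is \<open>p * a + (1 - p) * b = ((2 * a + b) - (2 - 3 * p) * (a -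
  b)) / 3\<close>. Adding the last three hypotheses bounds \<open>2 * a + b\<close> by
  \<open>3 * c\<close>, and the subtracted term is nonnegative.\<close>

lemma average_bound:
  fixes p :: real
  assumes "0 \<le> p" "p \<le> 1 / 2" "b1 \<le> a1" "b2 \<le> a2" "b3 \<le> a3"
    and "b1 + a2 + a3 \<le> c" "b2 + a1 + a3 \<le> c" "b3 + a1 + a2 \<le> c"
  shows "(p * a1 + (1 - p) * b1) + (p * a2 + (1 - p) * b2) + (p * a3 + (1 - p) * b3) \<le> c"
proof -
  let ?a = "a1 + a2 + a3" and ?b = "b1 + b2 + b3"
  have "(2 - 3 * p) * ?b \<le> (2 - 3 * p) * ?a"
    using assms by (intro mult_left_mono) auto
  moreover have "2 * ?a + ?b \<le> 3 * c"
    using assms(6-8) by argo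
  ultimately show ?thesis by (simp add: algebra_simps)
qed

lemma mu_triple_le:
  assumes p: "1 / 3 \<le> p" "p \<le> 1 / 2" and "finite S" "triple S F1 F2 F3"
  shows "mu S p F1 + mu S p F2 + mu S p F3 \<le> 3 * p"
  using assms(3-)
proof (induction S arbitrary: F1 F2 F3 rule: finite_induct)
  case empty
  then show ?case by (simp add: not_triple_empty)
next
  case (insert x S)
  have p0: "0 \<le> p" "p \<le> 1" using p by auto
  let ?l = "\<lambda>F. mu S p (link x F)" and ?d = "\<lambda>F. mu S p (del x F)"
  have split: "mu (insert x S) p F = p * ?l F + (1 - p) * ?d F"
    and le1: "?l F \<le> 1" and dl: "?d F \<le> ?l F" if "upset_on (insert x S) F" for F
    using mu_split[OF insert.hyps, of F p] mu_le_1[OF p0 insert.hyps(1), of "link x F"]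
      mu_mono[OF p0 insert.hyps(1), of "link x F" "del x F"] that insert.hyps
    by (simp_all add: upset_on_subset upset_on_link del_subset_link)
  have sum_eq: "mu (insert x S) p F + mu (insert x S) p G + mu (insert x S) p H
      = (p * ?l F + (1 - p) * ?d F) + (p * ?l G + (1 - p) * ?d G) + (p * ?l H + (1 - p) * ?d H)"
    if "triple (insert x S) F G H" for F G H
    using triple_upset[OF that] by (simp add: split)
  have IH: "?d F + ?l G + ?l H \<le> 3 * p" if "triple (insert x S) F G H" "del x F \<noteq> {}" for F G H
    using insert.IH[OF triple_del_link[OF that(1) insert.hyps(2) that(2)]] .
  \<comment> \<open>Fixing one member of \<open>F\<close> makes the deletion of \<open>G\<close> and
    the link of \<open>H\<close> cross intersecting as a pair. The form without nonemptiness is used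
    because the deletion may be empty.\<close>
  have cross: "?d G + ?l H \<le> 1" if t: "triple (insert x S) F G H" for F G H
  proof (rule mu_cross_intersecting2_le_1)
    show "upset_on S (del x G)" "upset_on S (link x H)"
      using triple_upset[OF t] insert.hyps by (auto intro: upset_on_del upset_on_link)
    obtain C where C: "C \<in> F"
      using triple_nonempty(1)[OF t] by blast
    fix A B
    assume "A \<in> del x G" "B \<in> link x H"
    then have "C \<inter> A \<inter> insert x B \<noteq> {}" "x \<notin> A"
      using triple_inter[OF t C] unfolding del_def link_def by blast+
    then show "A \<inter> B \<noteq> {}" by blast
  qed (use p insert.hyps in auto)
  have one: "mu (insert x S) p F + mu (insert x S) p G + mu (insert x S) p H \<le> 3 * p"
    if t: "triple (insert x S) F G H" and e: "del x F = {}" "del x G \<noteq> {}" "del x H \<noteq> {}" for F G H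
  proof -
    \<comment> \<open>Averaging the two available induction hypotheses gives
      \<open>?l F \<le> 3 * p - s\<close>, and the two mixed pairs give \<open>s \<le> 1\<close>.
      Since \<open>p \<le> 1 / 2\<close>, the contribution of \<open>G\<close> and \<open>H\<close>
      is at most \<open>s\<close>, so the total is at most \<open>p * (3 * p - s) + s\<close>, which
      increases with \<open>s\<close>.\<close>
    define s where "s = (?l G + ?l H + ?d G + ?d H) / 2"
    have "?d G + ?l F + ?l H \<le> 3 * p" "?d H + ?l F + ?l G \<le> 3 * p"
      using IH[of G F H] IH[of H F G] t e by (auto intro: triple_swap)
    then have f: "?l F \<le> 3 * p - s"
      by (simp add: s_def field_simps)
    have s1: "s \<le> 1"
      using cross[OF t] cross[OF triple_swap(2)[OF t]] by (simp add: s_def)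
    have "p * ?l F \<le> p * (3 * p - s)" "(1 - p) * s \<le> (1 - p) * 1"
      using f s1 p by (auto intro!: mult_left_mono)
    moreover have "(1 / 2 - p) * (?d G + ?d H) \<le> (1 / 2 - p) * (?l G + ?l H)"
      using p dl triple_upset[OF t] by (intro mult_left_mono add_mono) auto
    then have "p * (?l G + ?l H) + (1 - p) * (?d G + ?d H) \<le> s"
      by (simp add: s_def field_simps)
    ultimately have "p * ?l F + (p * (?l G + ?l H) + (1 - p) * (?d G + ?d H)) \<le> 3 * p\<^sup>2 + 1 - p"
      by (simp add: algebra_simps power2_eq_square)
    then show ?thesis
      unfolding sum_eq[OF t] using e quadratic_le[OF p] by (simp add: algebra_simps)
  qed
  have two: "mu (insert x S) p F + mu (insert x S) p G + mu (insert x S) p H \<le> 3 * p"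
    if t: "triple (insert x S) F G H" and e: "del x F = {}" "del x G = {}" "del x H \<noteq> {}" for F G H
  proof -
    have "?d H + ?l F + ?l G \<le> 3 * p"
      using IH[of H F G] t e by (auto intro: triple_swap)
    \<comment> \<open>The total is \<open>p\<close> times this sum plus
      \<open>p * ?l H + (1 - 2 * p) * ?d H\<close>. The last two terms are bounded trivially by
      \<open>p + (1 - 2 * p)\<close>.\<close>
    then have "p * (?d H + ?l F + ?l G) \<le> p * (3 * p)"
      using p by (intro mult_left_mono) auto
    moreover have "?l H \<le> 1" "?d H \<le> 1"
      using le1[OF triple_upset(3)[OF t]] dl[OF triple_upset(3)[OF t]] by linarith+
    then have "p * ?l H \<le> p * 1" "(1 - 2 * p) * ?d H \<le> (1 - 2 * p) * 1"
      using p by (intro mult_left_mono; simp)+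
    ultimately show ?thesis
      unfolding sum_eq[OF t] using e quadratic_le[OF p]
      by (simp add: algebra_simps power2_eq_square)
  qed
  note t = insert.prems
  \<comment> \<open>All six orderings, so that \<open>one\<close> and \<open>two\<close> cover every
    position of the empty deletions.\<close>
  note t' = t triple_swap(1)[OF t] triple_swap(2)[OF t] triple_swap(1)[OF triple_swap(2)[OF t]]
    triple_swap(2)[OF triple_swap(1)[OF t]]
    triple_swap(1)[OF triple_swap(2)[OF triple_swap(1)[OF t]]]
  show ?case
  proof (cases "del x F1 = {}"; cases "del x F2 = {}"; cases "del x F3 = {}")
    assume "del x F1 = {}" "del x F2 = {}" "del x F3 = {}"
    then show ?thesis
      unfolding sum_eq[OF t] using triple_upset[OF t, THEN le1]
        triple_upset[OF t, THEN le1, THEN mult_left_mono, OF p0(1)] by simp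
  next
    assume e: "del x F1 \<noteq> {}" "del x F2 \<noteq> {}" "del x F3 \<noteq> {}"
    show ?thesis
      unfolding sum_eq[OF t]
      by (rule average_bound) (use p dl triple_upset[OF t] IH t' e in auto)
  qed (use one two t' in \<open>smt (verit)\<close>)+
qed

section \<open>Exceptional configurations for the sharper bound\<close>

lemma quadratic_bound:
  fixes p :: real
  shows "2 * p + p\<^sup>2 \<le> 3 * p - (2 - 3 * p) * (3 * p - 1)"
proof -
  \<comment> \<open>This is the gap between the two sides. The right side equals
    \<open>1 + (3 * p - 1)^2\<close>.\<close>
  have "0 \<le> 2 * (2 * p - 1)\<^sup>2" by simp
  then show ?thesis by (simp add: algebra_simps power2_eq_square)
qed

text \<open>The target is \<open>1 + (3 * p - 1)^2\<close>, so the claim concerns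
  \<open>2 * p ^ n - (1 - p) ^ n\<close>. Passing from \<open>n\<close> to \<open>Suc n\<close>
  multiplies this by \<open>p\<close> and adds the nonpositive term
  \<open>(2 * p - 1) * (1 - p) ^ n\<close>. The induction starts at 2, since the claim fails at
  \<open>n = 1\<close> for \<open>p\<close> above 1/3.\<close>

lemma power_bound:
  fixes p :: real
  assumes "1 / 3 \<le> p" "p \<le> 1 / 2" "2 \<le> n"
  shows "1 - (1 - p) ^ n + 2 * p ^ n \<le> 3 * p - (2 - 3 * p) * (3 * p - 1)"
proof -
  have "2 * p ^ n - (1 - p) ^ n \<le> (3 * p - 1)\<^sup>2"
    using assms(3)
  proof (induction n rule: dec_induct)
    case base
    then show ?case
      using quadratic_bound[of p] by (simp add: algebra_simps power2_eq_square)
  next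
    case (step n)
    have "(2 * p - 1) * (1 - p) ^ n \<le> 0"
      using assms by (intro mult_nonpos_nonneg) auto
    then have "2 * p ^ Suc n - (1 - p) ^ Suc n \<le> p * (2 * p ^ n - (1 - p) ^ n)"
      by (simp add: algebra_simps)
    also have "\<dots> \<le> p * (3 * p - 1)\<^sup>2"
      using step.IH assms by (intro mult_left_mono) auto
    also have "\<dots> \<le> 1 * (3 * p - 1)\<^sup>2"
      using assms by (intro mult_right_mono) auto
    finally show ?case by simp
  qed
  then show ?thesis by (simp add: algebra_simps power2_eq_square)
qed

text \<open>The member \<open>S\<close> imposes no restriction, so \<open>F\<close> and
  \<open>G\<close> are cross intersecting as a pair, while \<open>{S}\<close> contributes only
  \<open>p ^ card S\<close>.\<close>

lemma mu_triple_singleton: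
  assumes p: "1 / 3 \<le> p" "p \<le> 1 / 2" and "finite S" "2 \<le> card S" "triple S {S} F G"
  shows "mu S p {S} + mu S p F + mu S p G \<le> 3 * p - (2 - 3 * p) * (3 * p - 1)"
proof -
  have "mu S p F + mu S p G \<le> 1 - (1 - p) ^ card S + p ^ card S"
    by (rule mu_cross_intersecting2)
      (use assms in \<open>fastforce simp: triple_def nonempty_cross_intersecting3_def
          cross_intersecting3_def upset_on_def\<close>)+
  then show ?thesis
    using power_bound[OF p assms(4)] by (simp add: mu_whole)
qed

text \<open>Because \<open>S\<close> itself lies in the deletion of \<open>F\<close>, the links of
  \<open>G\<close> and \<open>H\<close> at \<open>x\<close> form a cross intersecting pair. The link
  of \<open>F\<close> is bounded by 1, and the deletions contribute only the weight of
  \<open>S\<close>.\<close>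

lemma mu_triple_almost_star:
  assumes p: "1 / 3 \<le> p" "p \<le> 1 / 2" and S: "finite S" "x \<notin> S"
    and t: "triple (insert x S) F G H" and d: "del x F = {S}" "del x G = {}" "del x H = {}"
  shows "mu (insert x S) p F + mu (insert x S) p G + mu (insert x S) p H
    \<le> 3 * p - (2 - 3 * p) * (3 * p - 1)"
proof -
  let ?m = "card S"
  have u: "upset_on (insert x S) F" "upset_on (insert x S) G" "upset_on (insert x S) H"
    by (fact triple_upset[OF t])+
  have ne: "link x G \<noteq> {}" "link x H \<noteq> {}"
    by (intro link_nonempty[OF _ S(2)] u triple_nonempty[OF t])+
  have c: "A \<inter> B \<noteq> {}" if "A \<in> link x G" "B \<in> link x H" for A B
    using triple_inter[OF triple_del_link[OF t S(2)], of S A B] d(1) that by blast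
  have "1 \<le> ?m"
  proof (rule ccontr)
    assume "\<not> 1 \<le> ?m"
    then have "S = {}" using S by (simp add: not_le)
    then show False
      using triple_del_link[OF t S(2)] d(1) not_triple_empty by auto
  qed
  have "mu S p (link x G) + mu S p (link x H) \<le> 1 - (1 - p) ^ ?m + p ^ ?m"
    using p S u ne c by (intro mu_cross_intersecting2 upset_on_link) auto
  moreover have "mu S p (link x F) \<le> 1"
    using p S u by (intro mu_le_1 upset_on_subset upset_on_link) auto
  ultimately have "mu S p (link x F) + (mu S p (link x G) + mu S p (link x H))
      \<le> 1 + (1 - (1 - p) ^ ?m + p ^ ?m)"
    by (rule add_mono[rotated])
  then have "p * (mu S p (link x F) + (mu S p (link x G) + mu S p (link x H)))
      \<le> p * (1 + (1 - (1 - p) ^ ?m + p ^ ?m))"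
    using p by (intro mult_left_mono) auto
  then have "mu (insert x S) p F + mu (insert x S) p G + mu (insert x S) p H
      \<le> 2 * p + (p ^ ?m - p * (1 - p) ^ ?m)"
    unfolding u[THEN upset_on_subset, THEN mu_split[OF S]] d
    by (simp add: mu_whole algebra_simps)
  \<comment> \<open>For \<open>?m = 1\<close> this is an equality, in which the subtracted term
    matters. For larger \<open>?m\<close> already the first power is small enough.\<close>
  also have "p ^ ?m - p * (1 - p) ^ ?m \<le> p\<^sup>2"
  proof (cases "?m = 1")
    case True
    then show ?thesis by (simp add: algebra_simps power2_eq_square)
  next
    case False
    then have "p ^ ?m \<le> p\<^sup>2"
      using p \<open>1 \<le> ?m\<close> by (intro power_decreasing) auto
    moreover have "0 \<le> p * (1 - p) ^ ?m"
      using p by simp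
    ultimately show ?thesis by linarith
  qed
  finally show ?thesis
    using quadratic_bound[of p] by linarith
qed

section \<open>Shifted families: the sharper bound\<close>

lemma shiftedD:
  assumes "shifted n F" "A \<in> F" "1 \<le> i" "i < j" "j \<le> n" "i \<notin> A" "j \<in> A"
  shows "insert i (A - {j}) \<in> F"
proof -
  have "A \<inter> {i, j} = {j}" using assms by auto
  then show ?thesis using assms unfolding shifted_def by fastforce
qed

text \<open>Shifts inside \<open>{1..n}\<close> never move the largest element \<open>Suc n\<close>.
  This is why the induction below splits at \<open>Suc n\<close>.\<close>

lemma shifted_del: "shifted (Suc n) F \<Longrightarrow> shifted n (del (Suc n) F)"
  unfolding shifted_def del_def by auto

lemma shifted_link:
  assumes "shifted (Suc n) F"
  shows "shifted n (link (Suc n) F)"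
  unfolding shifted_def
proof (intro ballI allI impI, elim conjE)
  fix A i j
  assume A: "A \<in> link (Suc n) F" and ij: "1 \<le> i" "i < j" "j \<le> n" "A \<inter> {i, j} = {j}"
  have "Suc n \<notin> A" "insert (Suc n) A \<in> F"
    using A by (simp_all add: link_def)
  moreover have "j \<in> A" "i \<notin> A"
    using ij(2,4) by (blast, metis IntI insertI1 less_irrefl singletonD)
  ultimately have "insert i (insert (Suc n) A - {j}) \<in> F"
    using ij(1-3) by (intro shiftedD[OF assms, of "insert (Suc n) A"]) simp_all
  moreover have "insert i (insert (Suc n) A - {j}) = insert (Suc n) (A - {j} \<union> {i})"
    using ij(2,3) by auto
  ultimately show "A - {j} \<union> {i} \<in> link (Suc n) F"
    using \<open>Suc n \<notin> A\<close> ij(2,3) by (simp add: link_def)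
qed

text \<open>The empty total intersection is replaced by its consequence that 1 is not a common
  element. In the induction only this has to be checked for each triple of one deletion and two
  links.\<close>

lemma mu_shifted_triple_le:
  assumes p: "1 / 3 \<le> p" "p \<le> 1 / 2"
    and "triple {1..n} F1 F2 F3" "shifted n F1" "shifted n F2" "shifted n F3"
    and "\<exists>A\<in>F1 \<union> F2 \<union> F3. 1 \<notin> A"
  shows "mu {1..n} p F1 + mu {1..n} p F2 + mu {1..n} p F3 \<le> 3 * p - (2 - 3 * p) * (3 * p - 1)"
  using assms(3-)
proof (induction n arbitrary: F1 F2 F3)
  case 0
  then show ?case by (simp add: not_triple_empty)
next
  case (Suc n)
  let ?x = "Suc n" and ?S = "{1..n}" and ?c = "3 * p - (2 - 3 * p) * (3 * p - 1)"
  have S: "{1..?x} = insert ?x ?S" by auto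
  have x: "?x \<notin> ?S" by simp
  let ?l = "\<lambda>F. mu ?S p (link ?x F)" and ?d = "\<lambda>F. mu ?S p (del ?x F)"
  let ?good = "\<lambda>F G H. triple (insert ?x ?S) F G H \<and> shifted ?x F \<and> shifted ?x G \<and> shifted ?x H
    \<and> (\<exists>A\<in>F \<union> G \<union> H. 1 \<notin> A)"
  let ?sum = "\<lambda>F G H. mu (insert ?x ?S) p F + mu (insert ?x ?S) p G + mu (insert ?x ?S) p H"
  have good: "?good F1 F2 F3"
    using Suc.prems S by simp
  have good_swap: "?good G F H" "?good F H G" if "?good F G H" for F G H
    using that triple_swap by blast+
  have n1: "1 \<le> n"
  proof (rule ccontr)
    assume "\<not> 1 \<le> n"
    then have n: "n = 0" by simp
    obtain A where A: "A \<in> F1 \<union> F2 \<union> F3" "1 \<notin> A"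
      using good by blast
    moreover have "A \<subseteq> {1}"
      using A good n by (auto simp: triple_def upset_on_def)
    ultimately have "{} \<in> F1 \<union> F2 \<union> F3"
      by (metis subset_singletonD insertI1)
    then show False
      using good by (fastforce simp: triple_def nonempty_cross_intersecting3_def
          cross_intersecting3_def)
  qed
  have empty_del: "?sum F G H \<le> ?c" if g: "?good F G H" and e: "del ?x F = {}" for F G H
  proof -
    have "F = {insert ?x ?S}"
    proof -
      \<comment> \<open>A member missing some \<open>i\<close> could be shifted by replacing
        \<open>Suc n\<close> with \<open>i\<close>, which would produce a member of the empty
        deletion.\<close>
      have "A = insert ?x ?S" if A: "A \<in> F" for A
      proof (rule ccontr)
        assume "A \<noteq> insert ?x ?S"
        moreover have "A \<subseteq> insert ?x ?S" "?x \<in> A"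
          using A g e by (auto simp: triple_def upset_on_def del_def)
        ultimately obtain i where i: "i \<in> ?S" "i \<notin> A" by blast
        then have "insert i (A - {?x}) \<in> F"
          using g A \<open>?x \<in> A\<close> by (intro shiftedD[of ?x F A i ?x]) auto
        then have "insert i (A - {?x}) \<in> del ?x F"
          using i by (simp add: del_def)
        then show False using e by simp
      qed
      moreover have "F \<noteq> {}"
        using g by (simp add: triple_def nonempty_cross_intersecting3_def)
      ultimately show ?thesis by blast
    qed
    then show ?thesis
      using mu_triple_singleton[OF p, of "insert ?x ?S" G H] g n1 by simp
  qed
  \<comment> \<open>Either the smaller triple satisfies the induction hypothesis, or 1 is common to
    it. In the second case the desired bound is proved directly, hence the disjunction.\<close>
  have step: "?sum F G H \<le> ?c \<or> ?d F + ?l G + ?l H \<le> ?c"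
    if g: "?good F G H" and ne: "del ?x F \<noteq> {}" for F G H
  proof (cases "\<exists>A\<in>del ?x F \<union> link ?x G \<union> link ?x H. 1 \<notin> A")
    case True
    then show ?thesis
      using Suc.IH[of "del ?x F" "link ?x G" "link ?x H"] g ne x
      by (simp add: triple_del_link shifted_del shifted_link)
  next
    case False
    then have common: "1 \<in> A" if "A \<in> del ?x F \<or> A \<in> link ?x G \<or> A \<in> link ?x H" for A
      using that by auto
    \<comment> \<open>By up-closure, \<open>insert ?x A\<close> also lies in \<open>K\<close>, so
      \<open>A - {?x}\<close> belongs to the link and contains 1.\<close>
    have star: "1 \<in> A" if "A \<in> K" "upset_on (insert ?x ?S) K"
      "\<And>B. B \<in> link ?x K \<Longrightarrow> 1 \<in> B" for A K
    proof -
      have "insert ?x A \<in> K"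
        using upset_onD[OF that(2,1), of "insert ?x A"] upset_on_subset[OF that(2)] that(1) by blast
      then have "A - {?x} \<in> link ?x K"
        by (simp add: link_def)
      then show ?thesis using that(3) by blast
    qed
    have GH: "1 \<in> A" if "A \<in> G \<union> H" for A
      using star[of A G] star[of A H] that common g by (auto simp: triple_def)
    then obtain B where B: "B \<in> F" "1 \<notin> B"
      using g by blast
    \<comment> \<open>All of \<open>G\<close> and \<open>H\<close> contain 1, so the split now
      happens at 1, with \<open>T\<close> as the remaining ground set.\<close>
    define T where "T = insert ?x ?S - {1}"
    have T: "insert ?x ?S = insert 1 T" "finite T" "1 \<notin> T"
      using n1 by (auto simp: T_def)
    \<comment> \<open>A member avoiding 1 must contain \<open>Suc n\<close>, since every member of
      the deletion contains 1. If it missed another \<open>i\<close>, shifting \<open>Suc n\<close>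
      to \<open>i\<close> would give a member of the deletion avoiding 1.\<close>
    have eq: "A = T" if A: "A \<in> F" "1 \<notin> A" for A
    proof (rule ccontr)
      assume "A \<noteq> T"
      moreover have "A \<subseteq> T"
        using A g by (auto simp: T_def triple_def upset_on_def)
      moreover have xA: "?x \<in> A"
        using A common[of A] by (auto simp: del_def)
      ultimately obtain i where "i \<in> T" "i \<notin> A"
        by blast
      then have i: "i \<in> ?S" "i \<noteq> 1" "i \<notin> A"
        using xA by (auto simp: T_def)
      then have "insert i (A - {?x}) \<in> F"
        using g A xA by (intro shiftedD[of ?x F A i ?x]) auto
      then have "insert i (A - {?x}) \<in> del ?x F"
        using i by (simp add: del_def)
      then have "1 \<in> insert i (A - {?x})"
        by (intro common disjI1)
      then show False using A i by simp
    qed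
    then have "del 1 F = {T}" "del 1 G = {}" "del 1 H = {}"
      using B GH by (auto simp: del_def)
    then show ?thesis
      using mu_triple_almost_star[OF p T(2,3), of F G H] g T(1) by simp
  qed
  have "?sum F1 F2 F3 \<le> ?c"
  proof (rule ccontr)
    \<comment> \<open>Assuming the bound fails excludes the direct alternatives of
      \<open>empty_del\<close> and \<open>step\<close>, so all three inequalities needed for
      averaging are available.\<close>
    assume big: "\<not> ?thesis"
    note g = good good_swap(1)[OF good] good_swap(1)[OF good_swap(2)[OF good]]
    have ne: "del ?x F1 \<noteq> {}" "del ?x F2 \<noteq> {}" "del ?x F3 \<noteq> {}"
      using empty_del[OF g(1)] empty_del[OF g(2)] empty_del[OF g(3)] big by argo+
    have u: "upset_on (insert ?x ?S) F1" "upset_on (insert ?x ?S) F2" "upset_on (insert ?x ?S) F3"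
      using good by (simp_all add: triple_def)
    have dl: "?d F \<le> ?l F" if "upset_on (insert ?x ?S) F" for F
      using that p x by (intro mu_mono upset_on_subset upset_on_link del_subset_link) auto
    have "?sum F1 F2 F3 = (p * ?l F1 + (1 - p) * ?d F1) + (p * ?l F2 + (1 - p) * ?d F2)
        + (p * ?l F3 + (1 - p) * ?d F3)"
      using mu_split[OF _ x upset_on_subset] u by simp
    also have "\<dots> \<le> ?c"
    proof (rule average_bound)
      show "?d F1 + ?l F2 + ?l F3 \<le> ?c" "?d F2 + ?l F1 + ?l F3 \<le> ?c" "?d F3 + ?l F1 + ?l F2 \<le> ?c"
        using step[OF g(1) ne(1)] step[OF g(2) ne(2)] step[OF g(3) ne(3)] big by argo+
    qed (use p dl u in auto)
    finally show False using big by simp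
  qed
  then show ?case by (simp only: S)
qed

section \<open>Reduction to up-closures\<close>

lemma upset_on_up_closure: "upset_on S (up_closure S F)"
  unfolding upset_on_def up_closure_def by blast

lemma up_closureI: "A \<in> F \<Longrightarrow> A \<subseteq> B \<Longrightarrow> B \<subseteq> S \<Longrightarrow> B \<in> up_closure S F"
  by (auto simp: up_closure_def)

lemma subset_up_closure: "F \<subseteq> Pow S \<Longrightarrow> F \<subseteq> up_closure S F"
  unfolding up_closure_def by blast

text \<open>Let \<open>A\<close> be a member of \<open>F\<close> below \<open>B\<close>. If
  \<open>j\<close> lies in \<open>A\<close>, the shift of \<open>A\<close> lies below the shift of
  \<open>B\<close>; otherwise \<open>A\<close> itself does.\<close>

lemma shifted_up_closure:
  assumes "shifted n F"
  shows "shifted n (up_closure {1..n} F)"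
  unfolding shifted_def
proof (intro ballI allI impI, elim conjE)
  fix B i j
  assume B: "B \<in> up_closure {1..n} F" and ij: "1 \<le> i" "i < j" "j \<le> n" "B \<inter> {i, j} = {j}"
  then obtain A where A: "A \<in> F" "A \<subseteq> B" "B \<subseteq> {1..n}"
    by (auto simp: up_closure_def)
  have sub: "B - {j} \<union> {i} \<subseteq> {1..n}"
    using A ij by auto
  show "B - {j} \<union> {i} \<in> up_closure {1..n} F"
  proof (cases "j \<in> A")
    case True
    then have "insert i (A - {j}) \<in> F"
      using A ij by (intro shiftedD[OF assms]) auto
    moreover have "insert i (A - {j}) \<subseteq> B - {j} \<union> {i}"
      using A by auto
    ultimately show ?thesis
      using sub by (rule up_closureI)
  next
    case False
    then have "A \<subseteq> B - {j} \<union> {i}"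
      using A by auto
    then show ?thesis
      using sub by (rule up_closureI[OF A(1)])
  qed
qed

lemma triple_up_closure:
  assumes "F \<subseteq> Pow S" "G \<subseteq> Pow S" "H \<subseteq> Pow S" "nonempty_cross_intersecting3 F G H"
  shows "triple S (up_closure S F) (up_closure S G) (up_closure S H)"
proof -
  have "cross_intersecting3 (up_closure S F) (up_closure S G) (up_closure S H)"
    unfolding cross_intersecting3_def
  proof (intro ballI)
    fix A B C
    assume "A \<in> up_closure S F" "B \<in> up_closure S G" "C \<in> up_closure S H"
    then obtain A' B' C' where "A' \<in> F" "B' \<in> G" "C' \<in> H" and sub: "A' \<subseteq> A" "B' \<subseteq> B" "C' \<subseteq> C"
      by (auto simp: up_closure_def)
    then have "A' \<inter> B' \<inter> C' \<noteq> {}"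
      using assms(4) by (auto simp: nonempty_cross_intersecting3_def cross_intersecting3_def)
    then show "A \<inter> B \<inter> C \<noteq> {}"
      using sub by blast
  qed
  moreover have "up_closure S K \<noteq> {}" if "K \<subseteq> Pow S" "K \<noteq> {}" for K
    using subset_up_closure[OF that(1)] that(2) by auto
  ultimately show ?thesis
    using assms unfolding triple_def nonempty_cross_intersecting3_def
    by (simp add: upset_on_up_closure)
qed

theorem theorem7:
  fixes n :: nat and p :: real and \<F>1 \<F>2 \<F>3 :: "nat set set"
  assumes "n \<ge> 1"
    and "1 / 3 \<le> p" and "p \<le> 1 / 2"
    and "\<F>1 \<subseteq> Pow {1..n}" and "\<F>2 \<subseteq> Pow {1..n}" and "\<F>3 \<subseteq> Pow {1..n}"
    and "nonempty_cross_intersecting3 \<F>1 \<F>2 \<F>3"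
  shows "p_measure n p \<F>1 + p_measure n p \<F>2 + p_measure n p \<F>3 \<le> 3 * p \<and>
    (1 / 3 < p \<and> shifted n \<F>1 \<and> shifted n \<F>2 \<and> shifted n \<F>3 \<and>
      \<Inter>(\<F>1 \<union> \<F>2 \<union> \<F>3) = {} \<longrightarrow>
      p_measure n p \<F>1 + p_measure n p \<F>2 + p_measure n p \<F>3
        \<le> 3 * p - (2 - 3 * p) * (3 * p - 1))"
proof -
  let ?u = "up_closure {1..n}"
  have t: "triple {1..n} (?u \<F>1) (?u \<F>2) (?u \<F>3)"
    using assms by (intro triple_up_closure)
  have "p_measure n p F \<le> mu {1..n} p (?u F)" if "F \<subseteq> Pow {1..n}" for F
    unfolding p_measure_eq_mu
    using assms(2,3) subset_up_closure[OF that] upset_on_up_closure[THEN upset_on_subset]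
    by (intro mu_mono) simp_all
  then have le: "p_measure n p \<F>1 + p_measure n p \<F>2 + p_measure n p \<F>3
      \<le> mu {1..n} p (?u \<F>1) + mu {1..n} p (?u \<F>2) + mu {1..n} p (?u \<F>3)"
    using assms by (intro add_mono) auto
  show ?thesis
  proof (intro conjI impI, goal_cases)
    case 1
    then show ?case
      using le mu_triple_le[OF assms(2,3) _ t] by simp
  next
    case 2
    \<comment> \<open>A member avoiding 1 survives in the up-closures, because they contain the
      original families.\<close>
    then have "1 \<notin> \<Inter>(\<F>1 \<union> \<F>2 \<union> \<F>3)" by simp
    then have "\<exists>A\<in>?u \<F>1 \<union> ?u \<F>2 \<union> ?u \<F>3. 1 \<notin> A"
      using assms(4-6)[THEN subset_up_closure] by auto
    with 2 have "mu {1..n} p (?u \<F>1) + mu {1..n} p (?u \<F>2) + mu {1..n} p (?u \<F>3)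
        \<le> 3 * p - (2 - 3 * p) * (3 * p - 1)"
      using assms by (intro mu_shifted_triple_le t shifted_up_closure) auto
    then show ?case
      using le by linarith
  qed
qed

end
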